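(* Let $T_1$ and $T_2$ be isomorphic star trees, each with $n$ leaves. Let $v_1$ be the center of $T_1$ and $v_2,\dots,v_{n+1}$ its leaves. Then $$\operatorname{irr}(T_1\cong T_2)=2\sum_{i=2}^{n+1}|\deg_{T_1}(v_1)-\deg_{T_1}(v_i)|.$$
   Context: The Albertson (irregularity) index of a finite simple graph $G$ is $\operatorname{irr}(G)=\sum_{uv\in E(G)} |\deg_G(u)-\deg_G(v)|$. For isomorphic trees $T_1\cong T_2$, the notation $\operatorname{irr}(T_1\cong T_2)$ means $\operatorname{irr}(T_1)+\operatorname{irr}(T_2)$. Here $T_1\cong T_2$ means there is a bijection $f:V(T_1)\to V(T_2)$ such that $\{u,v\}\in E(T_1)$ if and only if $\{f(u),f(v)\}\in E(T_2)$. *)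

theory Defs
  imports "Graph_Theory.Graph_Theory"
begin

text \<open>
  Finite simple graphs are the locale \<^locale>\<open>graph\<close>, i.e. finite loop-free symmetric digraphs
  without parallel arcs. Each undirected edge is a pair of opposite arcs there, so sums over edges
  are taken over the set of endpoint sets below, which counts every edge once.
\<close>

definition edges :: "('a, 'b) pre_digraph \<Rightarrow> 'a set set" where
  "edges G = {{u, v} | u v. u \<rightarrow>\<^bsub>G\<^esub> v}"

definition degree :: "('a, 'b) pre_digraph \<Rightarrow> 'a \<Rightarrow> nat" where
  "degree G v = card {e \<in> edges G. v \<in> e}"

text \<open>
  The description is unique whenever \<^term>\<open>e\<close> is of the form \<open>{u, v}\<close>, because the absolute
  difference is symmetric in \<open>u\<close> and \<open>v\<close>; see \<open>edge_imbalance_doubleton\<close>.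
\<close>

definition edge_imbalance :: "('a, 'b) pre_digraph \<Rightarrow> 'a set \<Rightarrow> int" where
  "edge_imbalance G e =
    (THE d. \<exists>u v. e = {u, v} \<and> d = \<bar>int (degree G u) - int (degree G v)\<bar>)"

lemma edge_imbalance_doubleton:
  "edge_imbalance G {u, v} = \<bar>int (degree G u) - int (degree G v)\<bar>"
  unfolding edge_imbalance_def
  by (rule the_equality) (auto simp: doubleton_eq_iff)

definition irr :: "('a, 'b) pre_digraph \<Rightarrow> int" where
  "irr G = (\<Sum>e\<in>edges G. edge_imbalance G e)"

definition graph_iso :: "('a, 'b) pre_digraph \<Rightarrow> ('c, 'd) pre_digraph \<Rightarrow> bool" where
  "graph_iso G H \<longleftrightarrow> (\<exists>f. bij_betw f (verts G) (verts H) \<and>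
    (\<forall>u\<in>verts G. \<forall>v\<in>verts G. {u, v} \<in> edges G \<longleftrightarrow> {f u, f v} \<in> edges H))"

text \<open>
  The value written \<open>irr(G \<cong> H)\<close>; it is only meant for \<open>G\<close> and \<open>H\<close> with \<^term>\<open>graph_iso G H\<close>.
\<close>

definition irr_iso :: "('a, 'b) pre_digraph \<Rightarrow> ('c, 'd) pre_digraph \<Rightarrow> int" where
  "irr_iso G H = irr G + irr H"

text \<open>
  The predicate \<^const>\<open>tree\<close> cannot be used for undirected trees: its cycles include the walk
  \<open>u, v, u\<close> along an edge and back, so no symmetric digraph with an arc satisfies it. The star tree
  with \<open>n\<close> leaves is the complete bipartite graph with parts of size \<open>1\<close> and \<open>n\<close>.
\<close>

definition star_tree :: "nat \<Rightarrow> ('a, 'b) pre_digraph \<Rightarrow> bool" where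
  "star_tree n G \<longleftrightarrow> K\<^bsub>1,n\<^esub> G"

definition star_center :: "('a, 'b) pre_digraph \<Rightarrow> 'a \<Rightarrow> bool" where
  "star_center G c \<longleftrightarrow> c \<in> verts G \<and> (\<forall>x\<in>verts G - {c}. {c, x} \<in> edges G)"

text \<open>
  In a star with a single edge both vertices have degree one and either may serve as the center;
  the chosen center is not counted as a leaf.
\<close>

definition star_leaves :: "('a, 'b) pre_digraph \<Rightarrow> 'a \<Rightarrow> 'a set" where
  "star_leaves G c = {x \<in> verts G. x \<noteq> c \<and> degree G x = 1}"

end

theory Submission
  imports Defs
begin

text \<open>
  In a star every edge joins the center \<open>c\<close> to one other vertex, and every other vertex lies on
  exactly one edge. Hence the vertices other than \<open>c\<close> are precisely the leaves, and summing the
  imbalance over edges is the same as summing \<open>\<bar>deg c - deg x\<bar>\<close> over the leaves \<open>x\<close>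
  (\<open>irr_star_tree_sum\<close>). Since \<open>deg c = n\<close> and all leaves have degree one, this sum is
  \<open>n * \<bar>n - 1\<bar>\<close> (\<open>irr_star_tree\<close>), which depends on \<open>n\<close> only. So the two stars contribute equally,
  which gives the factor two.

  The center may be any vertex adjacent to all others. It differs from the one-element part of
  \<open>K\<^bsub>1,n\<^esub>\<close> only when the star is a single edge, and \<open>star_center_edges\<close> shows that the edges
  have the same description then; everything else uses only that description.
\<close>

lemma star_treeE:
  assumes "star_tree n G"
  obtains u V where "finite V" "u \<notin> V" "card V = n" "verts G = insert u V"
    "edges G = (\<lambda>x. {u, x}) ` V"
proof -
  from assms obtain U V where G: "graph G" and UV: "verts G = U \<union> V" "U \<inter> V = {}"
      "card U = 1" "card V = n" "arcs_ends G = U \<times> V \<union> V \<times> U"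
    unfolding star_tree_def complete_bipartite_digraph_def by blast
  interpret graph G by (rule G)
  from UV(3) obtain u where u: "U = {u}" by (rule card_1_singletonE)
  \<comment> \<open>Finiteness of \<open>V\<close> cannot come from its cardinality, which may be zero.\<close>
  have "finite V" using finite_verts UV(1) by simp
  moreover have "edges G = (\<lambda>x. {u, x}) ` V"
    unfolding edges_def UV(5) u by (auto simp: insert_commute)
  ultimately show thesis using that[of V u] UV u by auto
qed

lemma star_tree_has_center:
  assumes "star_tree n G"
  obtains c where "star_center G c"
proof -
  obtain u V where "verts G = insert u V" "edges G = (\<lambda>x. {u, x}) ` V"
    using assms by (rule star_treeE)
  then have "star_center G u" by (auto simp: star_center_def)
  then show thesis by (rule that)
qed

text \<open>
  Let \<open>u\<close> be the one-element part of \<open>K\<^bsub>1,n\<^esub>\<close>. A center \<open>c \<noteq> u\<close> is adjacent to \<open>u\<close> alone but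
  also to every vertex other than itself, so it is the only vertex besides \<open>u\<close>, and the roles of
  \<open>c\<close> and \<open>u\<close> can be exchanged.
\<close>

lemma star_center_edges:
  assumes star: "star_tree n G" and center: "star_center G c"
  shows "edges G = (\<lambda>x. {c, x}) ` (verts G - {c})" (is ?edges)
    and "card (verts G - {c}) = n" (is ?card)
proof -
  obtain u V where V: "finite V" "u \<notin> V" "card V = n" "verts G = insert u V"
    "edges G = (\<lambda>x. {u, x}) ` V"
    using star by (rule star_treeE)
  have "?edges \<and> ?card"
  proof (cases "c = u")
    case True
    then have "verts G - {c} = V" using V by auto
    then show ?thesis using V True by simp
  next
    case False
    then have "c \<in> V" using center V(4) by (auto simp: star_center_def)
    moreover have "x = c" if "x \<in> V" for x
    proof (rule ccontr)
      assume "x \<noteq> c"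
      then have "{c, x} \<in> edges G" using center that V(4) by (auto simp: star_center_def)
      then show False using V(2,5) that \<open>c \<in> V\<close> by (auto simp: doubleton_eq_iff)
    qed
    ultimately have "V = {c}" by blast
    then have "verts G - {c} = {u}" using V(4) False by auto
    then show ?thesis using V \<open>V = {c}\<close> by (auto simp: insert_commute)
  qed
  then show ?edges ?card by auto
qed

lemma degree_star_center:
  assumes "star_tree n G" "star_center G c"
  shows "degree G c = n"
proof -
  have "{e \<in> edges G. c \<in> e} = (\<lambda>x. {c, x}) ` (verts G - {c})"
    unfolding star_center_edges(1)[OF assms] by auto
  moreover have "inj_on (\<lambda>x. {c, x}) (verts G - {c})"
    by (auto simp: inj_on_def doubleton_eq_iff)
  ultimately show ?thesis
    unfolding degree_def by (simp add: card_image star_center_edges(2)[OF assms])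
qed

lemma degree_star_noncenter:
  assumes "star_tree n G" "star_center G c" "x \<in> verts G - {c}"
  shows "degree G x = 1"
proof -
  have "{e \<in> edges G. x \<in> e} = {{c, x}}"
    unfolding star_center_edges(1)[OF assms(1,2)] using assms(3) by auto
  then show ?thesis unfolding degree_def by simp
qed

lemma star_leaves_eq:
  assumes "star_tree n G" "star_center G c"
  shows "star_leaves G c = verts G - {c}"
  using degree_star_noncenter[OF assms] unfolding star_leaves_def by auto

lemma irr_star_tree_sum:
  assumes "star_tree n G" "star_center G c"
  shows "irr G = (\<Sum>x\<in>star_leaves G c. \<bar>int (degree G c) - int (degree G x)\<bar>)"
proof -
  have "inj_on (\<lambda>x. {c, x}) (verts G - {c})"
    by (auto simp: inj_on_def doubleton_eq_iff)
  then show ?thesis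
    unfolding irr_def star_center_edges(1)[OF assms] star_leaves_eq[OF assms]
    by (simp add: sum.reindex edge_imbalance_doubleton)
qed

lemma irr_star_tree:
  assumes "star_tree n G"
  shows "irr G = int n * \<bar>int n - 1\<bar>"
proof -
  obtain c where c: "star_center G c" using assms by (rule star_tree_has_center)
  have "irr G = (\<Sum>x\<in>verts G - {c}. \<bar>int n - 1\<bar>)"
    unfolding irr_star_tree_sum[OF assms c] star_leaves_eq[OF assms c]
    by (rule sum.cong) (simp_all add: degree_star_center[OF assms c] degree_star_noncenter[OF assms c])
  then show ?thesis by (simp add: star_center_edges(2)[OF assms c])
qed

theorem lemma3p3:
  fixes T1 :: "('a, 'b) pre_digraph" and T2 :: "('c, 'd) pre_digraph"
    and n :: nat and v :: "nat \<Rightarrow> 'a"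
  assumes "star_tree n T1" and "star_tree n T2"
    and "graph_iso T1 T2"
    and "star_center T1 (v 1)"
    and "bij_betw v {2..n + 1} (star_leaves T1 (v 1))"
  shows "irr_iso T1 T2 = 2 * (\<Sum>i = 2..n + 1. \<bar>int (degree T1 (v 1)) - int (degree T1 (v i))\<bar>)"
proof -
  have "irr T1 = (\<Sum>i = 2..n + 1. \<bar>int (degree T1 (v 1)) - int (degree T1 (v i))\<bar>)"
    unfolding irr_star_tree_sum[OF assms(1,4)]
    by (rule sum.reindex_bij_betw[OF assms(5), symmetric])
  moreover have "irr T2 = irr T1"
    by (simp add: irr_star_tree[OF assms(1)] irr_star_tree[OF assms(2)])
  ultimately show ?thesis by (simp add: irr_iso_def)
qed

end
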